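(* Let $\Omega\subset\mathbb{R}^n$ be a bounded convex subset, and let $A$ be a subset satisfying $\bar A\subset\Omega^{\mathrm{ri}}$. Then a convex function $f:\Omega-A\to\mathbb{R}$ can be extended to a convex function $\mathbb{R}^n\to\mathbb{R}$ on the whole linear space if and only if $f$ is Lipschitz on $\Omega-A$.
   Context: All functions are real valued and never take the values $\pm\infty$. $\Omega^{\mathrm{ri}}$ denotes the relative interior of $\Omega$ (interior relative to its affine hull), $\bar A$ the closure of $A$, and $\Omega-A$ the set difference. A function $f$ on a (not necessarily convex) set $S\subset\mathbb{R}^n$ is called convex if $f(x)\le \lambda_1 f(x_1)+\cdots+\lambda_k f(x_k)$ whenever $x_1,\dots,x_k\in S$, $\lambda_i\ge 0$, $\lambda_1+\cdots+\lambda_k=1$, and the convex combination $x=\lambda_1x_1+\cdots+\lambda_kx_k$ also lies in $S$. *)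

theory Defs
  imports "HOL-Analysis.Analysis"
begin

text \<open>
  The library predicate \<open>convex_on S f\<close> includes \<open>convex S\<close>. Here \<open>S\<close> is arbitrary, so Jensen's
  inequality is required for convex combinations of any finite number of points of \<open>S\<close> that
  happen to lie in \<open>S\<close> (on a non-convex \<open>S\<close>, two points do not suffice).
\<close>

definition convex_fun_on :: "'a::real_vector set \<Rightarrow> ('a \<Rightarrow> real) \<Rightarrow> bool" where
  "convex_fun_on S f \<longleftrightarrow>
     (\<forall>(k::nat) (x :: nat \<Rightarrow> 'a) (l :: nat \<Rightarrow> real).
        (\<forall>i<k. x i \<in> S \<and> 0 \<le> l i) \<longrightarrow>
        (\<Sum>i<k. l i) = 1 \<longrightarrow>
        (\<Sum>i<k. l i *\<^sub>R x i) \<in> S \<longrightarrow>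
        f (\<Sum>i<k. l i *\<^sub>R x i) \<le> (\<Sum>i<k. l i * f (x i)))"

lemma convex_fun_on_iff_convex_on:
  assumes "convex S"
  shows "convex_fun_on S f \<longleftrightarrow> convex_on S f"
proof
  assume R: "convex_fun_on S f"
  show "convex_on S f"
  proof (rule convex_onI)
    fix t :: real and x y
    assume t: "0 < t" "t < 1" and xy: "x \<in> S" "y \<in> S"
    let ?x = "\<lambda>i::nat. if i = 0 then x else y"
    let ?l = "\<lambda>i::nat. if i = 0 then 1 - t else t"
    have "(1 - t) *\<^sub>R x + t *\<^sub>R y \<in> S"
      using assms t xy by (simp add: convexD)
    then show "f ((1 - t) *\<^sub>R x + t *\<^sub>R y) \<le> (1 - t) * f x + t * f y"
      using R[unfolded convex_fun_on_def, rule_format, of 2 ?x ?l] t xy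
      by (simp add: numeral_2_eq_2)
  qed (fact assms)
next
  assume L: "convex_on S f"
  show "convex_fun_on S f"
    unfolding convex_fun_on_def
  proof (intro allI impI)
    fix k :: nat and x :: "nat \<Rightarrow> 'a" and l :: "nat \<Rightarrow> real"
    assume *: "\<forall>i<k. x i \<in> S \<and> 0 \<le> l i" "(\<Sum>i<k. l i) = 1"
    then have "k \<noteq> 0" by (intro notI) simp
    with * show "f (\<Sum>i<k. l i *\<^sub>R x i) \<le> (\<Sum>i<k. l i * f (x i))"
      by (intro convex_on_sum[OF _ _ L]) auto
  qed
qed

end

theory Submission
  imports Defs
begin

text \<open>
  A convex function on the whole space is bounded on balls, hence Lipschitz on bounded sets.

  Conversely, let \<open>f\<close> be \<open>L\<close>-Lipschitz and let \<open>K\<close> be the convex hull of its graph. The extension is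
  the infimal convolution \<open>g z = (INF (c, v)\<in>K. v + L * norm (z - c))\<close>, which is convex because it
  minimises a jointly convex function. It agrees with \<open>f\<close> provided
  \<open>f x \<le> v + L * norm (x - c)\<close> for every \<open>(c, v)\<in>K\<close>. By convexity along the ray from \<open>c\<close> through \<open>x\<close>,
  the slope from \<open>(c, v)\<close> to \<open>(x, f x)\<close> is at most the slope of \<open>f\<close> between two points
  further out on the ray, and such points exist outside \<open>A\<close> because the ray leaves \<open>closure A\<close> while it
  is still in the relative interior of \<open>\<Omega>\<close>.
\<close>

text \<open>Prolonging the segment from \<open>x\<close> to \<open>y\<close> by one unit beyond
  \<open>y\<close> stays in a slightly larger ball, where \<open>\<bar>g\<bar> \<le> B\<close>.
  Convexity bounds the slope from \<open>x\<close> to \<open>y\<close> by the slope of the longer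
  segment, which has length at least 1, so by \<open>2 * B\<close>.\<close>

lemma convex_on_UNIV_imp_lipschitz_on_bounded:
  fixes g :: "'a::euclidean_space \<Rightarrow> real"
  assumes g: "convex_on UNIV g" and "bounded S"
  shows "\<exists>L. L-lipschitz_on S g"
proof -
  obtain R where R: "\<And>x. x \<in> S \<Longrightarrow> norm x \<le> R"
    using \<open>bounded S\<close> by (auto simp: bounded_iff)
  have "continuous_on (cball 0 (R + 1)) g"
    using convex_on_continuous[OF open_UNIV g] continuous_on_subset by blast
  then have "bounded (g ` cball 0 (R + 1))"
    by (intro compact_imp_bounded compact_continuous_image) auto
  then obtain B where "B > 0" and "\<forall>x\<in>cball 0 (R + 1). \<bar>g x\<bar> \<le> B"
    unfolding bounded_pos by auto
  then have B: "\<And>x. norm x \<le> R + 1 \<Longrightarrow> \<bar>g x\<bar> \<le> B"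
    by simp
  have *: "g y - g x \<le> 2 * B * dist x y" if "x \<in> S" "y \<in> S" for x y
  proof (cases "x = y")
    case False
    define d where "d = norm (y - x)"
    have "d > 0" using False by (simp add: d_def)
    define z where "z = y + (1 / d) *\<^sub>R (y - x)"
    have "norm ((1 / d) *\<^sub>R (y - x)) = 1"
      using \<open>d > 0\<close> by (simp add: d_def)
    then have nz: "norm z \<le> R + 1"
      unfolding z_def using R[OF that(2)] norm_triangle_ineq[of y "(1 / d) *\<^sub>R (y - x)"] by linarith
    \<comment> \<open>The weight that places \<open>y\<close> between \<open>x\<close> and
      \<open>z\<close>, which are \<open>d + 1\<close> apart; \<open>t \<le> d\<close> later turns
      the bound into one linear in the distance.\<close>
    define t where "t = d / (d + 1)"
    have "d + d * d > 0" using \<open>d > 0\<close> by (simp add: add_pos_pos)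
    then have t: "0 \<le> t" "t \<le> 1" "t \<le> d" "t * (1 + 1 / d) = 1"
      using \<open>d > 0\<close> by (auto simp: t_def field_simps)
    have "(1 - t) *\<^sub>R x + t *\<^sub>R z = x + (t * (1 + 1 / d)) *\<^sub>R (y - x)"
      by (simp add: z_def algebra_simps)
    then have "y = (1 - t) *\<^sub>R x + t *\<^sub>R z"
      unfolding t(4) by simp
    then have "g y \<le> (1 - t) * g x + t * g z"
      using convex_onD[OF g, of t x z] t by simp
    then have "g y - g x \<le> t * (g z - g x)"
      by (simp add: algebra_simps)
    also have "\<dots> \<le> t * (2 * B)"
      using B[OF nz] B[of x] R[OF that(1)] t by (intro mult_left_mono) auto
    also have "\<dots> \<le> d * (2 * B)"
      using t \<open>B > 0\<close> by (intro mult_right_mono) auto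
    finally show ?thesis
      by (simp add: d_def dist_norm norm_minus_commute mult.commute)
  qed simp
  have "(2 * B)-lipschitz_on S g"
  proof (rule lipschitz_onI)
    fix x y assume "x \<in> S" "y \<in> S"
    then show "dist (g x) (g y) \<le> 2 * B * dist x y"
      using *[of x y] *[of y x] by (auto simp: dist_real_def dist_commute abs_le_iff)
  qed (use \<open>B > 0\<close> in simp)
  then show ?thesis ..
qed

text \<open>A point of the hull is a finite convex combination of graph points, so this is Jensen's
  inequality with arbitrarily many points, the form that \<open>convex_fun_on\<close> demands on a
  non-convex set.\<close>

lemma convex_fun_on_le_graph_hull:
  assumes f: "convex_fun_on S f"
    and "(x, v) \<in> convex hull ((\<lambda>x. (x, f x)) ` S)" and "x \<in> S"
  shows "f x \<le> v"
proof -
  obtain k u y where u: "\<forall>i\<in>{1::nat..k}. 0 \<le> u i \<and> y i \<in> (\<lambda>x. (x, f x)) ` S"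
    and u1: "sum u {1..k} = 1" and xv: "(\<Sum>i = 1..k. u i *\<^sub>R y i) = (x, v)"
    using assms(2) unfolding convex_hull_indexed by blast
  \<comment> \<open>The hull is indexed from 1, \<open>convex_fun_on\<close> from 0, hence the
    shift.\<close>
  define p where "p i = fst (y (Suc i))" for i
  define l where "l i = u (Suc i)" for i
  have y: "y (Suc i) = (p i, f (p i))" "p i \<in> S" "0 \<le> l i" if "i < k" for i
    using bspec[OF u, of "Suc i"] that by (auto simp: p_def l_def)
  have "(\<Sum>i<k. l i) = 1"
    using u1 by (simp add: l_def sum.atLeast1_atMost_eq)
  moreover have "(x, v) = (\<Sum>i<k. l i *\<^sub>R (p i, f (p i)))"
    unfolding xv[symmetric] One_nat_def sum.atLeast1_atMost_eq by (intro sum.cong) (auto simp: y l_def)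
  then have "x = (\<Sum>i<k. l i *\<^sub>R p i)" "v = (\<Sum>i<k. l i * f (p i))"
    by (simp_all add: prod_eq_iff fst_sum snd_sum)
  ultimately show ?thesis
    using f[unfolded convex_fun_on_def, rule_format, of k p l] \<open>x \<in> S\<close> y by simp
qed

text \<open>The hypothesis \<open>le\<close> serves twice: at one point \<open>x0\<close> it keeps
  the infimum finite everywhere, and at each \<open>x\<close> in \<open>S\<close> it gives
  \<open>f x \<le> g x\<close>. The reverse inequality takes the graph point over \<open>x\<close>
  as competitor.\<close>

lemma convex_fun_on_lipschitz_extension:
  fixes f :: "'a::real_normed_vector \<Rightarrow> real"
  assumes "L \<ge> 0"
    and le: "\<And>x c v. x \<in> S \<Longrightarrow> (c, v) \<in> convex hull ((\<lambda>x. (x, f x)) ` S)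
                \<Longrightarrow> f x \<le> v + L * norm (x - c)"
  shows "\<exists>g. convex_on UNIV g \<and> (\<forall>x\<in>S. g x = f x)"
proof (cases "S = {}")
  case True
  then show ?thesis by (auto intro!: exI[of _ "\<lambda>_. 0"] simp: convex_on_def)
next
  case False
  then obtain x0 where "x0 \<in> S" by auto
  define K where "K = convex hull ((\<lambda>x. (x, f x)) ` S)"
  define h where "h z = (\<lambda>(c, v). v + L * norm (z - c))" for z :: 'a
  define g where "g z = (INF q\<in>K. h z q)" for z
  have graph: "(x, f x) \<in> K" if "x \<in> S" for x
    unfolding K_def using that by (intro hull_inc) auto
  have "K \<noteq> {}" using graph[OF \<open>x0 \<in> S\<close>] by auto
  have "f x0 - L * norm (x0 - z) \<le> h z q" if "q \<in> K" for z q
  proof -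
    obtain c v where q: "q = (c, v)" by (cases q)
    have "f x0 \<le> v + L * norm (x0 - c)"
      using le[OF \<open>x0 \<in> S\<close>] that by (simp add: q K_def)
    also have "\<dots> \<le> v + L * (norm (x0 - z) + norm (z - c))"
      using norm_triangle_ineq[of "x0 - z" "z - c"] \<open>L \<ge> 0\<close> by (auto intro!: mult_left_mono)
    finally show ?thesis by (simp add: h_def q algebra_simps)
  qed
  then have bdd: "bdd_below (h z ` K)" for z
    by (intro bdd_belowI2)
  have "g x = f x" if "x \<in> S" for x
  proof (rule antisym)
    have "g x \<le> h x (x, f x)"
      unfolding g_def using bdd graph[OF that] by (rule cINF_lower)
    then show "g x \<le> f x" by (simp add: h_def)
    show "f x \<le> g x"
      unfolding g_def using \<open>K \<noteq> {}\<close> le[OF that]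
      by (intro cINF_greatest) (auto simp: h_def K_def)
  qed
  moreover have "convex_on UNIV g"
  proof (rule convex_onI)
    fix t :: real and x y :: 'a
    assume t: "0 < t" "t < 1"
    show "g ((1 - t) *\<^sub>R x + t *\<^sub>R y) \<le> (1 - t) * g x + t * g y"
    \<comment> \<open>The infimum need not be attained, so near-minimisers \<open>p\<close> and
      \<open>q\<close> are combined with the weights of \<open>x\<close> and
      \<open>y\<close>.\<close>
    proof (rule field_le_epsilon)
      fix e :: real assume "e > 0"
      have "\<exists>q\<in>K. h z q < g z + e" for z
        using cINF_less_iff[OF \<open>K \<noteq> {}\<close> bdd, of z "g z + e"] \<open>e > 0\<close> by (simp add: g_def)
      then obtain p q where p: "p \<in> K" "h x p < g x + e" and q: "q \<in> K" "h y q < g y + e"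
        by metis
      obtain a v b w where pq: "p = (a, v)" "q = (b, w)" by (cases p, cases q)
      let ?r = "(1 - t) *\<^sub>R p + t *\<^sub>R q"
      have "?r \<in> K"
        unfolding K_def using p q t by (intro convexD[OF convex_convex_hull]) (auto simp: K_def)
      then have "g ((1 - t) *\<^sub>R x + t *\<^sub>R y) \<le> h ((1 - t) *\<^sub>R x + t *\<^sub>R y) ?r"
        unfolding g_def using bdd by (intro cINF_lower)
      also have "\<dots> = (1 - t) * v + t * w + L * norm ((1 - t) *\<^sub>R (x - a) + t *\<^sub>R (y - b))"
        by (simp add: h_def pq algebra_simps)
      also have "\<dots> \<le> (1 - t) * v + t * w + L * ((1 - t) * norm (x - a) + t * norm (y - b))"
        using t \<open>L \<ge> 0\<close> norm_triangle_ineq[of "(1 - t) *\<^sub>R (x - a)" "t *\<^sub>R (y - b)"]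
        by (auto intro!: mult_left_mono)
      also have "\<dots> = (1 - t) * h x p + t * h y q"
        by (simp add: h_def pq algebra_simps)
      also have "\<dots> \<le> (1 - t) * (g x + e) + t * (g y + e)"
        using t p q by (intro add_mono mult_left_mono) auto
      finally show "g ((1 - t) *\<^sub>R x + t *\<^sub>R y) \<le> (1 - t) * g x + t * g y + e"
        by (simp add: algebra_simps)
    qed
  qed simp
  ultimately show ?thesis by blast
qed

text \<open>Beyond the last point of the ray in \<open>C\<close> no point lies in \<open>C\<close>;
  as that point is in the relative interior, the segment from \<open>c\<close> can still be
  prolonged a little inside \<open>\<Omega>\<close>. Two such points are provided so that a slope
  can be taken between them.\<close>

lemma ray_exits_compact_in_rel_interior:
  fixes c x :: "'a::euclidean_space"
  assumes "convex \<Omega>" and "compact C" and "C \<subseteq> rel_interior \<Omega>"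
    and "c \<in> \<Omega>" and "x \<in> C" and "x \<noteq> c"
  obtains a b where "1 < a" "a < b" "c + a *\<^sub>R (x - c) \<in> \<Omega> - C" "c + b *\<^sub>R (x - c) \<in> \<Omega> - C"
proof -
  define p where "p t = c + t *\<^sub>R (x - c)" for t :: real
  define T where "T = {1..} \<inter> p -` C"
  have "closed T"
    unfolding T_def p_def using compact_imp_closed[OF \<open>compact C\<close>]
    by (intro closed_Int closed_atLeast closed_vimage continuous_intros)
  moreover have "bounded T"
  proof -
    obtain B where B: "\<And>y. y \<in> C \<Longrightarrow> norm y \<le> B"
      using compact_imp_bounded[OF \<open>compact C\<close>] by (auto simp: bounded_iff)
    have "norm t \<le> (B + norm c) / norm (x - c)" if "t \<in> T" for t
    proof -
      have "norm (t *\<^sub>R (x - c)) = norm (p t - c)" by (simp add: p_def)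
      also have "\<dots> \<le> B + norm c"
        using B[of "p t"] that norm_triangle_ineq4[of "p t" c] by (auto simp: T_def)
      finally show ?thesis using \<open>x \<noteq> c\<close> by (simp add: pos_le_divide_eq)
    qed
    then show ?thesis unfolding bounded_iff by blast
  qed
  moreover have "1 \<in> T" using \<open>x \<in> C\<close> by (simp add: T_def p_def)
  ultimately obtain s where s: "s \<in> T" and max: "\<And>t. t \<in> T \<Longrightarrow> t \<le> s"
    using compact_attains_sup[of T] compact_eq_bounded_closed by blast
  then have "p s \<in> rel_interior \<Omega>" "s \<ge> 1"
    using \<open>C \<subseteq> rel_interior \<Omega>\<close> by (auto simp: T_def)
  then obtain m where m: "m > 1" "\<And>e. e > 1 \<and> e \<le> m \<Longrightarrow> (1 - e) *\<^sub>R c + e *\<^sub>R p s \<in> \<Omega>"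
    using convex_rel_interior_if[OF \<open>convex \<Omega>\<close>, of "p s"] hull_inc[OF \<open>c \<in> \<Omega>\<close>] by metis
  \<comment> \<open>Maximality of \<open>s\<close> excludes \<open>C\<close>, and the choice of
    \<open>m\<close> keeps the point in \<open>\<Omega>\<close>.\<close>
  have exit: "p (e * s) \<in> \<Omega> - C" if "e > 1" "e \<le> m" for e
  proof -
    have "p (e * s) = (1 - e) *\<^sub>R c + e *\<^sub>R p s"
      by (simp add: p_def algebra_simps)
    moreover have "e * s > s" using that \<open>s \<ge> 1\<close> by simp
    then have "e * s \<notin> T" "e * s \<ge> 1" using max[of "e * s"] \<open>s \<ge> 1\<close> by linarith+
    ultimately show ?thesis using m(2)[of e] that by (auto simp: T_def)
  qed
  show ?thesis
  proof (rule that)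
    have "1 * s < (1 + m) / 2 * s"
      using m \<open>s \<ge> 1\<close> by (intro mult_strict_right_mono) auto
    then show "1 < (1 + m) / 2 * s" using \<open>s \<ge> 1\<close> by linarith
    show "(1 + m) / 2 * s < m * s"
      using m \<open>s \<ge> 1\<close> by (intro mult_strict_right_mono) auto
    show "c + ((1 + m) / 2 * s) *\<^sub>R (x - c) \<in> \<Omega> - C" "c + (m * s) *\<^sub>R (x - c) \<in> \<Omega> - C"
      using exit[of "(1 + m) / 2"] exit[of m] m by (auto simp: p_def)
  qed
qed

lemma lipschitz_le_graph_hull_cone:
  fixes f :: "'a::euclidean_space \<Rightarrow> real"
  assumes "bounded \<Omega>" and "convex \<Omega>" and "A \<subseteq> \<Omega>" and A: "closure A \<subseteq> rel_interior \<Omega>"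
    and f: "convex_fun_on (\<Omega> - A) f" and L: "L-lipschitz_on (\<Omega> - A) f"
    and "x \<in> \<Omega> - A" and cv: "(c, v) \<in> convex hull ((\<lambda>x. (x, f x)) ` (\<Omega> - A))"
  shows "f x \<le> v + L * norm (x - c)"
proof (cases "x = c")
  case True
  then show ?thesis
    using convex_fun_on_le_graph_hull[OF f] assms(7) cv by simp
next
  case False
  define K where "K = convex hull ((\<lambda>x. (x, f x)) ` (\<Omega> - A))"
  have "L \<ge> 0" using L lipschitz_on_nonneg by blast
  have "K \<subseteq> \<Omega> \<times> UNIV"
    unfolding K_def using \<open>convex \<Omega>\<close> by (intro hull_minimal convex_Times) auto
  with cv have "c \<in> \<Omega>" by (auto simp: K_def)
  have between: "f (c + s *\<^sub>R (z - c)) \<le> (1 - s) * v + s * f z"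
    if "z \<in> \<Omega> - A" "0 \<le> s" "s \<le> 1" "c + s *\<^sub>R (z - c) \<in> \<Omega> - A" for s z
  proof -
    have "(1 - s) *\<^sub>R (c, v) + s *\<^sub>R (z, f z) \<in> K"
      unfolding K_def using that cv
      by (intro convexD[OF convex_convex_hull]) (auto intro: hull_inc)
    then have "(c + s *\<^sub>R (z - c), (1 - s) * v + s * f z) \<in> K"
      by (simp add: algebra_simps)
    then show ?thesis
      using convex_fun_on_le_graph_hull[OF f] that unfolding K_def by blast
  qed
  \<comment> \<open>The slope from \<open>(c, v)\<close> to the graph over the intermediate point is
    at most the slope from there to \<open>z\<close>, which is at most \<open>L\<close>. Strictness
    of \<open>s < 1\<close> allows cancelling \<open>1 - s\<close>.\<close>
  have inner: "f (c + s *\<^sub>R (z - c)) \<le> v + L * (s * norm (z - c))"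
    if "z \<in> \<Omega> - A" "0 \<le> s" "s < 1" "c + s *\<^sub>R (z - c) \<in> \<Omega> - A" for s z
  proof -
    let ?y = "c + s *\<^sub>R (z - c)"
    have "z - ?y = (1 - s) *\<^sub>R (z - c)" by (simp add: algebra_simps)
    then have "f z - f ?y \<le> L * ((1 - s) * norm (z - c))"
      using lipschitz_onD[OF L that(1,4)] that by (simp add: dist_norm)
    then have "s * (f z - f ?y) \<le> s * (L * ((1 - s) * norm (z - c)))"
      using that by (intro mult_left_mono)
    then have "(1 - s) * (f ?y - v) \<le> (1 - s) * (L * (s * norm (z - c)))"
      using between[of z s] that by (simp add: algebra_simps)
    then show ?thesis using that by simp
  qed
  show ?thesis
  proof (cases "x \<in> closure A")
    \<comment> \<open>Points of the segment from \<open>c\<close> to \<open>x\<close> near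
      \<open>x\<close> may lie in \<open>A\<close>, so the slope is bounded at the nearer of two
      exit points and carried back to \<open>x\<close> along the chord from
      \<open>(c, v)\<close>.\<close>
    case True
    have "compact (closure A)"
      using bounded_subset[OF \<open>bounded \<Omega>\<close> \<open>A \<subseteq> \<Omega>\<close>] by simp
    then obtain a b where ab: "1 < a" "a < b"
      and "c + a *\<^sub>R (x - c) \<in> \<Omega> - closure A" "c + b *\<^sub>R (x - c) \<in> \<Omega> - closure A"
      using ray_exits_compact_in_rel_interior[OF \<open>convex \<Omega>\<close> _ A \<open>c \<in> \<Omega>\<close> True False] by metis
    then have S: "c + a *\<^sub>R (x - c) \<in> \<Omega> - A" "c + b *\<^sub>R (x - c) \<in> \<Omega> - A"
      using closure_subset[of A] by auto
    let ?y = "c + a *\<^sub>R (x - c)"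
    have "f ?y \<le> v + L * (a * norm (x - c))"
      using inner[OF S(2), of "a / b"] S(1) ab by simp
    moreover have "f x \<le> (1 - 1 / a) * v + 1 / a * f ?y"
      using between[OF S(1), of "1 / a"] ab \<open>x \<in> \<Omega> - A\<close> by simp
    moreover have "1 / a * f ?y \<le> 1 / a * (v + L * (a * norm (x - c)))"
      using calculation(1) ab by (intro mult_left_mono) auto
    ultimately show ?thesis using ab by (simp add: algebra_simps)
  next
    \<comment> \<open>A ball around \<open>x\<close> misses \<open>A\<close>, so no exit points are
      needed: \<open>x\<close> itself is the outer point, and the inner one lies slightly towards
      \<open>c\<close>.\<close>
    case False
    then obtain e where "e > 0" and e: "ball x e \<subseteq> - closure A"
      using open_contains_ball[of "- closure A"] by auto
    define d where "d = norm (x - c)"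
    have "d > 0" using \<open>x \<noteq> c\<close> by (simp add: d_def)
    \<comment> \<open>Chosen so that \<open>(1 - s) * d = e * d / (e + d) < e\<close>, which keeps
      the inner point within the ball.\<close>
    define s where "s = d / (e + d)"
    have s: "0 \<le> s" "s < 1" "(1 - s) * d < e"
      using \<open>d > 0\<close> \<open>e > 0\<close> by (auto simp: s_def field_simps)
    let ?y = "c + s *\<^sub>R (x - c)"
    have "x - ?y = (1 - s) *\<^sub>R (x - c)" by (simp add: algebra_simps)
    then have dist: "dist x ?y = (1 - s) * d"
      using s by (simp add: dist_norm d_def)
    then have "?y \<notin> A" using e s closure_subset[of A] by (auto simp: subset_iff)
    moreover have "?y = (1 - s) *\<^sub>R c + s *\<^sub>R x" by (simp add: algebra_simps)
    then have "?y \<in> \<Omega>"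
      using convexD[OF \<open>convex \<Omega>\<close> \<open>c \<in> \<Omega>\<close>, of x "1 - s" s] s \<open>x \<in> \<Omega> - A\<close> by simp
    ultimately have y: "?y \<in> \<Omega> - A" by simp
    have "f x \<le> f ?y + L * ((1 - s) * d)"
      using lipschitz_onD[OF L \<open>x \<in> \<Omega> - A\<close> y] dist by (simp add: dist_real_def)
    also have "\<dots> \<le> v + L * (s * d) + L * ((1 - s) * d)"
      using inner[OF \<open>x \<in> \<Omega> - A\<close> s(1,2) y] by (simp add: d_def)
    finally show ?thesis by (simp add: d_def algebra_simps)
  qed
qed

theorem theorem4p2:
  fixes \<Omega> A :: "(real ^ 'n) set" and f :: "real ^ 'n \<Rightarrow> real"
  assumes "bounded \<Omega>" and "convex \<Omega>"
    and "A \<subseteq> \<Omega>" and "closure A \<subseteq> rel_interior \<Omega>"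
    and "convex_fun_on (\<Omega> - A) f"
  shows "(\<exists>g :: real ^ 'n \<Rightarrow> real. convex_fun_on UNIV g \<and> (\<forall>x \<in> \<Omega> - A. g x = f x))
         \<longleftrightarrow> (\<exists>L. L-lipschitz_on (\<Omega> - A) f)"
proof
  assume "\<exists>g. convex_fun_on UNIV g \<and> (\<forall>x \<in> \<Omega> - A. g x = f x)"
  then obtain g where "convex_on UNIV g" and g: "\<And>x. x \<in> \<Omega> - A \<Longrightarrow> g x = f x"
    by (auto simp: convex_fun_on_iff_convex_on)
  then obtain L where "L-lipschitz_on (\<Omega> - A) g"
    using convex_on_UNIV_imp_lipschitz_on_bounded bounded_diff[OF \<open>bounded \<Omega>\<close>] by blast
  then have "L-lipschitz_on (\<Omega> - A) f"
    using g by (auto simp: lipschitz_on_def)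
  then show "\<exists>L. L-lipschitz_on (\<Omega> - A) f" ..
next
  assume "\<exists>L. L-lipschitz_on (\<Omega> - A) f"
  then obtain L where L: "L-lipschitz_on (\<Omega> - A) f" ..
  have "\<exists>g. convex_on UNIV g \<and> (\<forall>x\<in>\<Omega> - A. g x = f x)"
    using lipschitz_on_nonneg[OF L] lipschitz_le_graph_hull_cone[OF assms L]
    by (rule convex_fun_on_lipschitz_extension)
  then show "\<exists>g. convex_fun_on UNIV g \<and> (\<forall>x \<in> \<Omega> - A. g x = f x)"
    by (simp add: convex_fun_on_iff_convex_on)
qed

end
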